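(* Let $f:\mathbb{R}^n\to\mathbb{R}$ be continuously differentiable and $m_f$-strongly convex ($m_f>0$) with $L_f$-Lipschitz continuous gradient. Let $g:\mathbb{R}^n\to\mathbb{R}\cup\{+\infty\}$ be proper, lower semicontinuous, convex and non-differentiable. Let $\mu>0$, let $k_1,k_3>0$ be arbitrary, put $$k_2^{\mathrm{crit}}=-k_3-\frac{k_1^2\mu}{2k_3}\,\frac{L_f^2}{m_f}<0,$$ and let $k_2<k_2^{\mathrm{crit}}$. Consider the dynamics $$\dot x=-\nabla f(x)-\nabla M_{\mu g}(x+\mu\alpha),\qquad \dot\alpha=k_1\nabla f(x)+k_2\alpha+k_3\nabla M_{\mu g}(x+\mu\alpha),$$ with state $\zeta=[x^\top,\alpha^\top]^\top\in\mathbb{R}^{2n}$. The problem $\min_{x\in\mathbb{R}^n} f(x)+g(x)$ is strongly convex and thus admits a unique global optimum, denoted by $\zeta^\star=[x^{\star\top},\alpha^{\star\top}]^\top$ ($x^\star$ being the minimizer and $\alpha^\star$ the associated multiplier); as a consequence, the dynamics admits a unique equilibrium point, namely $\zeta^\star$. Then the dynamics is globally exponentially stable with rate $$r=\min\left(m_f,\,-2\,(k_2-k_2^{\mathrm{crit}})\right)>0,$$ i.e., for every solution $\zeta(t)$ there exists $c\in\mathbb{R}_+$ such that $$\|\zeta(t)-\zeta^\star\|^2\le c\,e^{-\frac12 r t}\qquad\text{for all } t\ge0 .$$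
   Context: For $\mu>0$ and a proper lower semicontinuous convex function $g$, the proximal operator is $\mathrm{prox}_{\mu g}(v)=\arg\min_{x\in\mathbb{R}^n}\left(g(x)+\frac1{2\mu}\|x-v\|_2^2\right)$ and the Moreau envelope is $M_{\mu g}(v)=\inf_{x\in\mathbb{R}^n}\left(g(x)+\frac1{2\mu}\|x-v\|_2^2\right)$; the latter is continuously differentiable with $\nabla M_{\mu g}(v)=\frac1\mu\bigl(v-\mathrm{prox}_{\mu g}(v)\bigr)$. The variable $\alpha\in\mathbb{R}^n$ is the Lagrange multiplier of the constraint $x-z=0$ in the equivalent formulation $\min_{x,z} f(x)+g(z)$ subject to $x-z=0$. An equilibrium point is a point at which the right-hand sides of both equations of the dynamics vanish. The norm is the Euclidean norm.
   Formalization: The optimum is an equilibrium only if the gradient of f vanishes at the minimizer, so the claim that they coincide is false in general; the formal theorem proves a unique equilibrium, gives this criterion, and proves exponential convergence to the equilibrium instead of the optimum. *)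

theory Defs
  imports "HOL-Analysis.Analysis"
begin

definition gradient :: "('a::euclidean_space \<Rightarrow> real) \<Rightarrow> 'a \<Rightarrow> 'a" where
  "gradient f x = (THE D. GDERIV f x :> D)"

definition C1 :: "('a::euclidean_space \<Rightarrow> real) \<Rightarrow> bool" where
  "C1 f \<longleftrightarrow> f differentiable_on UNIV \<and> continuous_on UNIV (gradient f)"

definition strongly_convex :: "real \<Rightarrow> ('a::euclidean_space \<Rightarrow> real) \<Rightarrow> bool" where
  "strongly_convex m f \<longleftrightarrow>
     (\<forall>x y. \<forall>u\<ge>0. \<forall>v\<ge>0. u + v = 1 \<longrightarrow>
        f (u *\<^sub>R x + v *\<^sub>R y) \<le> u * f x + v * f y - m / 2 * u * v * (norm (x - y))\<^sup>2)"

definition proper_fun :: "('a \<Rightarrow> ereal) \<Rightarrow> bool" where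
  "proper_fun g \<longleftrightarrow> (\<forall>x. g x \<noteq> -\<infinity>) \<and> (\<exists>x. g x \<noteq> \<infinity>)"

definition lower_semicontinuous :: "('a::topological_space \<Rightarrow> ereal) \<Rightarrow> bool" where
  "lower_semicontinuous g \<longleftrightarrow> (\<forall>x. g x \<le> Liminf (at x) g)"

text \<open>In \<^typ>\<open>ereal\<close> we have \<open>0 * \<infinity> = 0\<close>, so the cases \<open>u = 0\<close> and \<open>v = 0\<close> are harmless;
  the notion is only used for functions that avoid \<open>-\<infinity>\<close>.\<close>

definition ereal_convex :: "('a::real_vector \<Rightarrow> ereal) \<Rightarrow> bool" where
  "ereal_convex g \<longleftrightarrow>
     (\<forall>x y. \<forall>u\<ge>0. \<forall>v\<ge>0. u + v = 1 \<longrightarrow>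
        g (u *\<^sub>R x + v *\<^sub>R y) \<le> ereal u * g x + ereal v * g y)"

text \<open>Differentiability everywhere requires finiteness everywhere; requiring the latter explicitly
  makes the totalisation \<open>real_of_ereal \<infinity> = 0\<close> irrelevant.\<close>

definition ereal_differentiable :: "('a::euclidean_space \<Rightarrow> ereal) \<Rightarrow> bool" where
  "ereal_differentiable g \<longleftrightarrow>
     (\<forall>x. \<bar>g x\<bar> \<noteq> \<infinity>) \<and> (\<lambda>x. real_of_ereal (g x)) differentiable_on UNIV"

text \<open>The infimum is finite when \<open>g\<close> is proper, lower semicontinuous and convex and \<open>\<mu> > 0\<close>.\<close>

definition moreau_env :: "real \<Rightarrow> ('a::euclidean_space \<Rightarrow> ereal) \<Rightarrow> 'a \<Rightarrow> real" where
  "moreau_env \<mu> g v = real_of_ereal (INF x. g x + ereal (1 / (2 * \<mu>) * (norm (x - v))\<^sup>2))"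

definition global_minimizer :: "('a \<Rightarrow> real) \<Rightarrow> ('a \<Rightarrow> ereal) \<Rightarrow> 'a \<Rightarrow> bool" where
  "global_minimizer f g x \<longleftrightarrow> (\<forall>y. ereal (f x) + g x \<le> ereal (f y) + g y)"

definition lagrangian ::
    "('a::euclidean_space \<Rightarrow> real) \<Rightarrow> ('a \<Rightarrow> ereal) \<Rightarrow> 'a \<Rightarrow> 'a \<Rightarrow> 'a \<Rightarrow> ereal" where
  "lagrangian f g x z \<alpha> = ereal (f x) + g z + ereal (\<alpha> \<bullet> (x - z))"

text \<open>The second conjunct says that \<open>\<alpha>\<close> is a Lagrange multiplier of \<open>x - z = 0\<close> at the feasible
  point \<open>(x, x)\<close> of the split problem; for the functions considered here it amounts to
  \<open>\<nabla>f(x) + \<alpha> = 0\<close> and \<open>\<alpha> \<in> \<partial>g(x)\<close>.\<close>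

definition optimal_pair ::
    "('a::euclidean_space \<Rightarrow> real) \<Rightarrow> ('a \<Rightarrow> ereal) \<Rightarrow> 'a \<times> 'a \<Rightarrow> bool" where
  "optimal_pair f g = (\<lambda>(x, \<alpha>).
     global_minimizer f g x \<and>
     (\<forall>x' z'. lagrangian f g x x \<alpha> \<le> lagrangian f g x' z' \<alpha>))"

text \<open>The state \<open>(x, \<alpha>)\<close> lives in a product space, whose norm is the Euclidean one,
  \<open>sqrt ((norm x)\<^sup>2 + (norm \<alpha>)\<^sup>2)\<close>.\<close>

definition dynamics ::
    "('a::euclidean_space \<Rightarrow> real) \<Rightarrow> ('a \<Rightarrow> ereal) \<Rightarrow> real \<Rightarrow> real \<Rightarrow> real \<Rightarrow> real \<Rightarrow> 'a \<times> 'a \<Rightarrow> 'a \<times> 'a"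
  where
  "dynamics f g \<mu> k1 k2 k3 = (\<lambda>(x, \<alpha>).
     (- gradient f x - gradient (moreau_env \<mu> g) (x + \<mu> *\<^sub>R \<alpha>),
      k1 *\<^sub>R gradient f x + k2 *\<^sub>R \<alpha> + k3 *\<^sub>R gradient (moreau_env \<mu> g) (x + \<mu> *\<^sub>R \<alpha>)))"

text \<open>At an optimal pair the second component of the dynamics equals
  \<open>(k1 - k2 - k3) \<nabla>f(x)\<close>, so optimal pairs and equilibria are different notions unless
  \<open>k2 = k1 - k3\<close> or \<open>\<nabla>f(x) = 0\<close>.\<close>

definition equilibrium :: "('b::real_vector \<Rightarrow> 'b) \<Rightarrow> 'b \<Rightarrow> bool" where
  "equilibrium F \<zeta> \<longleftrightarrow> F \<zeta> = 0"

definition solution :: "('b::real_normed_vector \<Rightarrow> 'b) \<Rightarrow> (real \<Rightarrow> 'b) \<Rightarrow> bool" where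
  "solution F \<zeta> \<longleftrightarrow> (\<forall>t\<ge>0. (\<zeta> has_vector_derivative F (\<zeta> t)) (at t within {0..}))"

definition k2_crit :: "real \<Rightarrow> real \<Rightarrow> real \<Rightarrow> real \<Rightarrow> real \<Rightarrow> real" where
  "k2_crit \<mu> k1 k3 m L = - k3 - k1\<^sup>2 * \<mu> / (2 * k3) * (L\<^sup>2 / m)"

definition rate :: "real \<Rightarrow> real \<Rightarrow> real \<Rightarrow> real \<Rightarrow> real \<Rightarrow> real \<Rightarrow> real" where
  "rate \<mu> k1 k2 k3 m L = min m (- 2 * (k2 - k2_crit \<mu> k1 k3 m L))"

end

theory Submission
  imports Defs
begin

text \<open>The stability proof is a quadratic Lyapunov argument. Write \<open>\<psi>\<close> for the gradient of the Moreau
envelope, and \<open>d\<close> and \<open>e\<close> for the differences of \<open>\<nabla>f\<close> and of \<open>\<psi>\<close> between two states whose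
difference is \<open>(x, a)\<close>. Strong convexity gives \<open>d \<bullet> x \<ge> m \<parallel>x\<parallel>\<^sup>2\<close>, and firm nonexpansiveness of the
proximal operator gives \<open>e \<bullet> (x + \<mu> a) \<ge> \<mu> \<parallel>e\<parallel>\<^sup>2\<close>. In the weighted inner product
\<open>x \<bullet> x' + (\<mu> / k3) (a \<bullet> a')\<close> the two cross terms \<open>- e \<bullet> x\<close> and \<open>\<mu> (e \<bullet> a)\<close> then combine into at most
\<open>2 \<mu> (e \<bullet> a) - \<mu> \<parallel>e\<parallel>\<^sup>2 \<le> \<mu> \<parallel>a\<parallel>\<^sup>2\<close>, which explains the summand \<open>- k3\<close> of the critical gain. The
remaining cross term, in \<open>d \<bullet> a\<close>, is bounded by the Lipschitz constant and split by Young's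
inequality: half of the strong convexity of \<open>f\<close> pays for it, and what is left over in \<open>\<parallel>a\<parallel>\<^sup>2\<close> is the
other summand of the critical gain. Hence the vector field is strongly dissipative with constant
\<open>r / 2\<close> in the weighted inner product (\<open>k2_crit_dissipation\<close>).

The unique equilibrium and the decay of solutions follow from this single inequality. A Lipschitz strongly
monotone map has exactly one zero, because a short explicit step along it is a contraction
(\<open>ex1_zero_strongly_monotone\<close>); and along a solution the squared weighted distance to the
equilibrium decays like \<open>exp (- r t)\<close> (\<open>dissipative_exponential_decay\<close>), which is even faster than
the asserted \<open>exp (- r t / 2)\<close>. Passing between the weighted and the Euclidean norm only changes the
constant \<open>c\<close>.

The optimization side rests on existence and uniqueness of the minimizer of a strongly convex
function plus a closed convex one (\<open>ex1_global_minimizer\<close>), used twice: for the problem \<open>f + g\<close>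
itself, and for the quadratic \<open>\<parallel>x - v\<parallel>\<^sup>2 / (2 \<mu>)\<close> in place of \<open>f\<close>, where it defines the proximal
operator. In both cases Fermat's rule (\<open>global_minimizer_subgradient\<close>) turns the minimizer into a
subgradient of \<open>g\<close>; this yields the multiplier \<open>- \<nabla>f(x)\<close> in the first case and the cocoercivity of
\<open>\<psi>\<close> in the second. At an optimal pair \<open>(x, \<alpha>)\<close>, the subgradient \<open>\<alpha> = - \<nabla>f(x)\<close> is the value of
\<open>\<psi>\<close> at \<open>x + \<mu> \<alpha>\<close>, so the first component of the dynamics vanishes and the second is a positive
multiple of \<open>\<nabla>f(x)\<close>.\<close>

section \<open>Gradients\<close>

lemma gderiv_unique:
  fixes f :: "'a::euclidean_space \<Rightarrow> real"
  assumes "GDERIV f x :> D" and "GDERIV f x :> E"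
  shows "D = E"
proof -
  have "(\<lambda>h. h \<bullet> D) = (\<lambda>h. h \<bullet> E)"
    using assms unfolding gderiv_def by (rule has_derivative_unique)
  then show ?thesis
    by (metis inner_commute vector_eq_rdot)
qed

lemma gradient_eqI: "GDERIV f x :> D \<Longrightarrow> gradient f x = D"
  for f :: "'a::euclidean_space \<Rightarrow> real"
  unfolding gradient_def by (blast intro: the_equality gderiv_unique)

lemma differentiable_imp_gderiv_gradient:
  fixes f :: "'a::euclidean_space \<Rightarrow> real"
  assumes "f differentiable at x"
  shows "GDERIV f x :> gradient f x"
proof -
  obtain f' where f': "(f has_derivative f') (at x)"
    using assms by (auto simp: differentiable_def)
  then interpret bounded_linear f' by (rule has_derivative_bounded_linear)
  have "f' h = h \<bullet> (\<Sum>b\<in>Basis. f' b *\<^sub>R b)" for h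
  proof -
    have "f' h = f' (\<Sum>b\<in>Basis. (h \<bullet> b) *\<^sub>R b)"
      by (simp add: euclidean_representation)
    also have "\<dots> = h \<bullet> (\<Sum>b\<in>Basis. f' b *\<^sub>R b)"
      by (simp add: sum scaleR inner_sum_right mult.commute)
    finally show ?thesis .
  qed
  then have "GDERIV f x :> (\<Sum>b\<in>Basis. f' b *\<^sub>R b)"
    using f' unfolding gderiv_def by (metis (no_types, lifting) ext)
  then show ?thesis
    using gradient_eqI by metis
qed

lemma gderiv_directional:
  fixes f :: "'a::euclidean_space \<Rightarrow> real"
  assumes "GDERIV f x :> D"
  shows "((\<lambda>t. (f (x + t *\<^sub>R d) - f x) / t) \<longlongrightarrow> D \<bullet> d) (at_right 0)"
proof -
  have "(f has_derivative (\<lambda>h. h \<bullet> D)) (at (x + 0 *\<^sub>R d))"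
    using assms by (simp add: gderiv_def)
  moreover have "((\<lambda>t. x + t *\<^sub>R d) has_derivative (\<lambda>t. t *\<^sub>R d)) (at 0)"
    by (auto intro!: derivative_eq_intros)
  ultimately have "((\<lambda>t. f (x + t *\<^sub>R d)) has_derivative (\<lambda>t. (t *\<^sub>R d) \<bullet> D)) (at 0)"
    using has_derivative_compose by blast
  then have "((\<lambda>t. f (x + t *\<^sub>R d)) has_field_derivative (D \<bullet> d)) (at 0)"
    by (simp add: has_field_derivative_def inner_commute mult_commute_abs)
  then show ?thesis
    by (auto simp: has_field_derivative_iff intro: tendsto_within_subset)
qed

text \<open>The strong convexity inequality on the segment from \<open>x\<close> to \<open>y\<close> bounds the difference quotients of
\<open>f\<close> at \<open>x\<close>; the claim is its limit for a vanishing step.\<close>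
lemma strongly_convex_first_order:
  fixes f :: "'a::euclidean_space \<Rightarrow> real"
  assumes sc: "strongly_convex m f" and D: "GDERIV f x :> D"
  shows "f x + D \<bullet> (y - x) + m / 2 * (norm (y - x))\<^sup>2 \<le> f y"
proof -
  let ?N = "m / 2 * (norm (y - x))\<^sup>2"
  have quot: "(f (x + t *\<^sub>R (y - x)) - f x) / t \<le> f y - f x - (1 - t) * ?N"
    if t: "0 < t" "t < 1" for t
  proof -
    have "f ((1 - t) *\<^sub>R x + t *\<^sub>R y)
        \<le> (1 - t) * f x + t * f y - m / 2 * (1 - t) * t * (norm (x - y))\<^sup>2"
      using sc t unfolding strongly_convex_def by simp
    moreover have "(1 - t) *\<^sub>R x + t *\<^sub>R y = x + t *\<^sub>R (y - x)"
      by (simp add: algebra_simps)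
    ultimately have "f (x + t *\<^sub>R (y - x)) - f x \<le> t * (f y - f x - (1 - t) * ?N)"
      by (simp add: algebra_simps norm_minus_commute)
    then show ?thesis
      using t by (simp add: field_simps)
  qed
  have "D \<bullet> (y - x) \<le> f y - f x - (1 - 0) * ?N"
  proof (rule tendsto_le[OF _ _ gderiv_directional[OF D]])
    show "((\<lambda>t. f y - f x - (1 - t) * ?N) \<longlongrightarrow> f y - f x - (1 - 0) * ?N) (at_right 0)"
      by (intro tendsto_intros)
    show "\<forall>\<^sub>F t in at_right 0. (f (x + t *\<^sub>R (y - x)) - f x) / t \<le> f y - f x - (1 - t) * ?N"
      using quot by (auto simp: eventually_at_right[of 0 1] intro!: exI[of _ 1])
  qed simp
  then show ?thesis by simp
qed

lemma strongly_convex_gradient_monotone: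
  fixes f :: "'a::euclidean_space \<Rightarrow> real"
  assumes sc: "strongly_convex m f" and D: "GDERIV f x :> D" and E: "GDERIV f y :> E"
  shows "m * (norm (x - y))\<^sup>2 \<le> (D - E) \<bullet> (x - y)"
proof -
  have "D \<bullet> (y - x) = - (D \<bullet> (x - y))"
    by (simp add: inner_diff_right)
  then show ?thesis
    using strongly_convex_first_order[OF sc D, of y] strongly_convex_first_order[OF sc E, of x]
    by (simp add: inner_diff_left norm_minus_commute)
qed

section \<open>Minimizers of strongly convex composite functions\<close>

lemma open_superlevel_lower_semicontinuous:
  fixes h :: "'a::topological_space \<Rightarrow> ereal"
  assumes "lower_semicontinuous h"
  shows "open {z. y < h z}"
proof (subst open_subopen, safe)
  fix x assume x: "y < h x"
  then have "\<forall>\<^sub>F z in at x. y < h z"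
    using assms unfolding lower_semicontinuous_def le_Liminf_iff by blast
  then obtain S where S: "open S" "x \<in> S" "\<And>z. z \<in> S \<Longrightarrow> z \<noteq> x \<Longrightarrow> y < h z"
    unfolding eventually_at_topological by blast
  have "S \<subseteq> {z. y < h z}"
  proof
    fix z assume "z \<in> S"
    then show "z \<in> {z. y < h z}"
      using S(3)[of z] x by (cases "z = x") auto
  qed
  with S(1,2) show "\<exists>T. open T \<and> x \<in> T \<and> T \<subseteq> {z. y < h z}"
    by (intro exI[of _ S]) simp
qed

text \<open>If the infimum were not attained, every point of \<open>K\<close> would lie in an open set
\<open>{z. h y < h z}\<close> with \<open>y \<in> K\<close>. Among the finitely many \<open>y\<close> of a subcover, the one with the least
value is covered by none of the sets.\<close>
lemma lower_semicontinuous_attains_inf: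
  fixes h :: "'a::topological_space \<Rightarrow> ereal"
  assumes lsc: "lower_semicontinuous h" and K: "compact K" "K \<noteq> {}"
  shows "\<exists>x\<in>K. \<forall>y\<in>K. h x \<le> h y"
proof (rule ccontr)
  assume "\<not> ?thesis"
  then have "K \<subseteq> (\<Union>y\<in>K. {z. h y < h z})"
    by (force simp: not_le)
  then obtain C where C: "C \<subseteq> K" "finite C" "K \<subseteq> (\<Union>y\<in>C. {z. h y < h z})"
    using compactE_image[OF K(1), of K "\<lambda>y. {z. h y < h z}"] open_superlevel_lower_semicontinuous[OF lsc] by metis
  then have "C \<noteq> {}"
    using K(2) by auto
  then obtain z where "z \<in> C" "\<forall>y\<in>C. h z \<le> h y"
    using C(2) by (metis arg_min_if_finite(1) arg_min_least)
  obtain y where "y \<in> C" "h y < h z"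
    using C(1,3) \<open>z \<in> C\<close> by blast
  then show False
    using \<open>\<forall>y\<in>C. h z \<le> h y\<close> by (meson leD)
qed

text \<open>Properness keeps the sum away from \<open>- \<infinity>\<close>, so a lower bound on the sum can be divided into a real
bound on each summand.\<close>
lemma lower_semicontinuous_add_continuous:
  fixes f :: "'a::topological_space \<Rightarrow> real"
  assumes f: "continuous_on UNIV f" and g: "proper_fun g" "lower_semicontinuous g"
  shows "lower_semicontinuous (\<lambda>x. ereal (f x) + g x)"
  unfolding lower_semicontinuous_def le_Liminf_iff
proof safe
  fix x y assume "y < ereal (f x) + g x"
  then obtain w where w: "y < ereal w" "ereal w < ereal (f x) + g x"
    using ereal_dense2 by blast
  then have "ereal (w - f x) < g x"
    by (cases "g x") auto
  then obtain v where v: "ereal (w - f x) < ereal v" "ereal v < g x"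
    using ereal_dense2 by blast
  have "\<forall>\<^sub>F z in at x. ereal v < g z"
    using g(2) v(2) unfolding lower_semicontinuous_def le_Liminf_iff by blast
  moreover have "\<forall>\<^sub>F z in at x. w - v < f z"
  proof (rule order_tendstoD(1))
    show "(f \<longlongrightarrow> f x) (at x)"
      using f by (auto simp: continuous_on_def)
  qed (use v in simp)
  ultimately show "\<forall>\<^sub>F z in at x. y < ereal (f z) + g z"
  proof eventually_elim
    case (elim z)
    then have "ereal w < ereal (f z) + g z"
      by (cases "g z") auto
    with w(1) show ?case by (rule less_trans)
  qed
qed

lemma ereal_convex_realD:
  assumes g: "proper_fun g" "ereal_convex g" and "g x = ereal a" "g y = ereal b"
    and "0 \<le> u" "0 \<le> v" "u + v = 1"
  obtains c where "g (u *\<^sub>R x + v *\<^sub>R y) = ereal c" "c \<le> u * a + v * b"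
proof -
  have "g (u *\<^sub>R x + v *\<^sub>R y) \<le> ereal u * g x + ereal v * g y"
    using assms unfolding ereal_convex_def by blast
  moreover have "g (u *\<^sub>R x + v *\<^sub>R y) \<noteq> - \<infinity>"
    using g(1) by (auto simp: proper_fun_def)
  ultimately show thesis
    using that assms(3,4) by (cases "g (u *\<^sub>R x + v *\<^sub>R y)") auto
qed

lemma strongly_convex_add_ereal_convex:
  assumes sc: "strongly_convex m f" and g: "proper_fun g" "ereal_convex g"
    and x: "ereal (f x) + g x = ereal a" and y: "ereal (f y) + g y = ereal b"
    and uv: "0 \<le> u" "0 \<le> v" "u + v = 1"
  shows "ereal (f (u *\<^sub>R x + v *\<^sub>R y)) + g (u *\<^sub>R x + v *\<^sub>R y)
    \<le> ereal (u * a + v * b - m / 2 * u * v * (norm (x - y))\<^sup>2)"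
proof -
  obtain p q where pq: "g x = ereal p" "g y = ereal q"
    using x y by (cases "g x"; cases "g y") auto
  then have ab: "a = f x + p" "b = f y + q"
    using x y by auto
  obtain c where c: "g (u *\<^sub>R x + v *\<^sub>R y) = ereal c" "c \<le> u * p + v * q"
    using ereal_convex_realD[OF g pq uv] .
  have "f (u *\<^sub>R x + v *\<^sub>R y) \<le> u * f x + v * f y - m / 2 * u * v * (norm (x - y))\<^sup>2"
    using sc uv unfolding strongly_convex_def by blast
  with c show ?thesis
    unfolding ab by (simp add: algebra_simps)
qed

lemma global_minimizer_finite:
  assumes g: "proper_fun g" and x: "global_minimizer f g x"
  obtains c where "g x = ereal c"
proof -
  obtain z where z: "g z \<noteq> \<infinity>"
    using g by (auto simp: proper_fun_def)
  have "ereal (f x) + g x \<le> ereal (f z) + g z"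
    using x by (simp add: global_minimizer_def)
  moreover have "g x \<noteq> - \<infinity>"
    using g by (auto simp: proper_fun_def)
  ultimately show thesis
    using z that by (cases "g x"; cases "g z") auto
qed

text \<open>Lower semicontinuity bounds the sum below on the unit ball around a point \<open>x0\<close> of finite value.
Strong convexity along the ray from \<open>x0\<close> through a far point \<open>x\<close>, evaluated where the ray leaves
the unit ball, propagates this bound: the value at \<open>x\<close> is at least the value at \<open>x0\<close> once a quadratic
term in the distance dominates a linear one. So a minimizer over a large ball is a global one.
Two minimizers coincide because their midpoint would otherwise do better.\<close>
lemma ex1_global_minimizer:
  fixes f :: "'a::euclidean_space \<Rightarrow> real"
  assumes f: "continuous_on UNIV f" "m > 0" "strongly_convex m f"
    and g: "proper_fun g" "lower_semicontinuous g" "ereal_convex g"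
  shows "\<exists>!x. global_minimizer f g x"
proof (rule ex_ex1I)
  define h where "h = (\<lambda>x. ereal (f x) + g x)"
  have lsc: "lower_semicontinuous h"
    unfolding h_def using f(1) g(1,2) by (rule lower_semicontinuous_add_continuous)
  have not_ninf: "h x \<noteq> - \<infinity>" for x
    using g(1) by (cases "g x") (auto simp: h_def proper_fun_def)
  obtain x0 where "g x0 \<noteq> \<infinity>"
    using g(1) by (auto simp: proper_fun_def)
  then obtain h0 where h0: "h x0 = ereal h0"
    using not_ninf[of x0] by (cases "g x0") (auto simp: h_def)
  obtain y0 where y0: "\<forall>y\<in>cball x0 1. h y0 \<le> h y"
    using lower_semicontinuous_attains_inf[OF lsc compact_cball[of x0 1]] by force
  have "h y0 \<le> h x0"
    using y0 by simp
  then obtain b where b: "h y0 = ereal b" "b \<le> h0"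
    using h0 not_ninf[of y0] by (cases "h y0") auto
  \<comment> \<open>Beyond this radius the quadratic term outweighs the linear loss permitted by the bound
    \<open>b\<close> on the unit ball.\<close>
  define R where "R = 1 + 2 * (h0 - b) / m"
  have R: "R \<ge> 1"
    using b(2) f(2) by (simp add: R_def)
  have far: "h x0 \<le> h x" if x: "dist x0 x > R" for x
  proof (cases "h x")
    case (real c)
    define d where "d = norm (x0 - x)"
    have d: "d > R" "d > 1"
      using x R by (auto simp: d_def dist_norm)
    define y where "y = (1 - 1 / d) *\<^sub>R x0 + (1 / d) *\<^sub>R x"
    have "x0 - y = (1 / d) *\<^sub>R (x0 - x)"
      by (simp add: y_def algebra_simps)
    then have "y \<in> cball x0 1"
      using d by (simp add: dist_norm d_def)
    then have "ereal b \<le> h y"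
      using y0 b(1) by force
    also have "h y \<le> ereal ((1 - 1 / d) * h0 + (1 / d) * c - m / 2 * (1 - 1 / d) * (1 / d) * d\<^sup>2)"
      unfolding h_def y_def d_def
      by (rule strongly_convex_add_ereal_convex[OF f(3) g(1,3)])
        (use h0 real d in \<open>auto simp: h_def d_def divide_le_eq_1\<close>)
    finally have "b \<le> (1 - 1 / d) * h0 + (1 / d) * c - m / 2 * (1 - 1 / d) * (1 / d) * d\<^sup>2"
      by simp
    then have "d * b \<le> d * ((1 - 1 / d) * h0 + (1 / d) * c - m / 2 * (1 - 1 / d) * (1 / d) * d\<^sup>2)"
      using d(2) by (intro mult_left_mono) auto
    also have "\<dots> = (d - 1) * h0 + c - m / 2 * (d - 1) * d"
      using d(2) by (simp add: field_simps power2_eq_square)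
    finally have "h0 + d * (m / 2 * (d - 1) - (h0 - b)) \<le> c"
      by (simp add: algebra_simps)
    moreover have "0 \<le> m / 2 * (d - 1) - (h0 - b)"
      using d(1) f(2) by (simp add: R_def field_simps)
    ultimately have "h0 \<le> c"
      using d(2) by (smt (verit) mult_nonneg_nonneg)
    then show ?thesis
      using real h0 by simp
  qed (use not_ninf in auto)
  obtain x1 where x1: "\<forall>y\<in>cball x0 R. h x1 \<le> h y"
    using lower_semicontinuous_attains_inf[OF lsc compact_cball[of x0 R]] R by force
  have "h x1 \<le> h y" for y
  proof (cases "dist x0 y > R")
    case True
    have "h x1 \<le> h x0"
      using x1 R by simp
    then show ?thesis
      using far[OF True] by order
  qed (use x1 in simp)
  then show "\<exists>x. global_minimizer f g x"
    by (auto simp: global_minimizer_def h_def)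
next
  fix x y assume x: "global_minimizer f g x" and y: "global_minimizer f g y"
  obtain p q where pq: "g x = ereal p" "g y = ereal q"
    using global_minimizer_finite[OF g(1)] x y by metis
  define z where "z = (1 / 2) *\<^sub>R x + (1 / 2) *\<^sub>R y"
  have "ereal (f x) + g x \<le> ereal (f y) + g y" "ereal (f y) + g y \<le> ereal (f x) + g x"
    using x y by (auto simp: global_minimizer_def)
  then have eq: "f x + p = f y + q"
    using pq by simp
  have "ereal (f x) + g x \<le> ereal (f z) + g z"
    using x by (simp add: global_minimizer_def)
  also have "\<dots> \<le> ereal (1 / 2 * (f x + p) + 1 / 2 * (f y + q)
      - m / 2 * (1 / 2) * (1 / 2) * (norm (x - y))\<^sup>2)"
    unfolding z_def
    by (rule strongly_convex_add_ereal_convex[OF f(3) g(1,3)]) (use pq in auto)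
  finally have "m * (norm (x - y))\<^sup>2 \<le> 0"
    using pq eq by simp
  then show "x = y"
    using f(2) by (simp add: mult_le_0_iff)
qed

text \<open>Fermat's rule: comparing \<open>x\<close> with \<open>x + t (z - x)\<close>, where convexity bounds the change of \<open>g\<close> by
\<open>t (g z - g x)\<close>, shows that \<open>g z - g x\<close> is at least minus the difference quotient of \<open>f\<close>, whose
limit is \<open>D \<bullet> (z - x)\<close>.\<close>
lemma global_minimizer_subgradient:
  fixes f :: "'a::euclidean_space \<Rightarrow> real"
  assumes g: "proper_fun g" "ereal_convex g"
    and x: "global_minimizer f g x" and D: "GDERIV f x :> D"
  shows "g x + ereal ((- D) \<bullet> (z - x)) \<le> g z"
proof -
  obtain a where a: "g x = ereal a"
    using global_minimizer_finite[OF g(1) x] .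
  show ?thesis
  proof (cases "g z")
    case (real b)
    have "a - b \<le> (f (x + t *\<^sub>R (z - x)) - f x) / t" if t: "0 < t" "t < 1" for t
    proof -
      obtain c where c: "g ((1 - t) *\<^sub>R x + t *\<^sub>R z) = ereal c" "c \<le> (1 - t) * a + t * b"
        using ereal_convex_realD[OF g a real, of "1 - t" t] t by auto
      have eq: "(1 - t) *\<^sub>R x + t *\<^sub>R z = x + t *\<^sub>R (z - x)"
        by (simp add: algebra_simps)
      have "ereal (f x) + g x \<le> ereal (f (x + t *\<^sub>R (z - x))) + g (x + t *\<^sub>R (z - x))"
        using x by (simp add: global_minimizer_def)
      then have "f x + a \<le> f (x + t *\<^sub>R (z - x)) + c"
        using a c(1) unfolding eq by simp
      then have "t * (a - b) \<le> f (x + t *\<^sub>R (z - x)) - f x"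
        using c(2) by (simp add: algebra_simps)
      then show ?thesis
        using t by (simp add: field_simps)
    qed
    then have "a - b \<le> D \<bullet> (z - x)"
      by (intro tendsto_lowerbound[OF gderiv_directional[OF D]])
        (auto simp: eventually_at_right[of 0 1] intro!: exI[of _ 1])
    then show ?thesis
      using a real by simp
  qed (use g(1) in \<open>auto simp: proper_fun_def\<close>)
qed

text \<open>Varying only \<open>x'\<close> in the Lagrangian inequality forces \<open>\<alpha> = - \<nabla>f(x)\<close>, as the step in direction
\<open>- (\<nabla>f(x) + \<alpha>)\<close> shows. Conversely, that multiplier is a subgradient of \<open>g\<close> at \<open>x\<close> by Fermat's
rule, so the Lagrangian separates into two convex functions, each minimized at \<open>x\<close>.\<close>
lemma optimal_pair_iff:
  fixes f :: "'a::euclidean_space \<Rightarrow> real"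
  assumes f: "\<And>x. GDERIV f x :> gradient f x" "m \<ge> 0" "strongly_convex m f"
    and g: "proper_fun g" "ereal_convex g"
  shows "optimal_pair f g (x, \<alpha>) \<longleftrightarrow> global_minimizer f g x \<and> \<alpha> = - gradient f x"
proof (cases "global_minimizer f g x")
  case False
  then show ?thesis by (simp add: optimal_pair_def)
next
  case x: True
  obtain a where a: "g x = ereal a"
    using global_minimizer_finite[OF g(1) x] .
  have "(\<forall>x' z'. lagrangian f g x x \<alpha> \<le> lagrangian f g x' z' \<alpha>) \<longleftrightarrow> \<alpha> = - gradient f x"
  proof
    assume le: "\<forall>x' z'. lagrangian f g x x \<alpha> \<le> lagrangian f g x' z' \<alpha>"
    have "- ((gradient f x + \<alpha>) \<bullet> (gradient f x + \<alpha>)) \<ge> 0"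
    proof (rule tendsto_lowerbound)
      let ?d = "- (gradient f x + \<alpha>)"
      have "((\<lambda>t. (f (x + t *\<^sub>R ?d) - f x) / t + \<alpha> \<bullet> ?d) \<longlongrightarrow> gradient f x \<bullet> ?d + \<alpha> \<bullet> ?d) (at_right 0)"
        by (intro tendsto_intros gderiv_directional f)
      then show "((\<lambda>t. (f (x + t *\<^sub>R ?d) - f x) / t + \<alpha> \<bullet> ?d)
          \<longlongrightarrow> - ((gradient f x + \<alpha>) \<bullet> (gradient f x + \<alpha>))) (at_right 0)"
        by (simp add: inner_add_left inner_add_right algebra_simps)
      have "0 \<le> (f (x + t *\<^sub>R ?d) - f x) / t + \<alpha> \<bullet> ?d" if "t > 0" for t
      proof -
        have "lagrangian f g x x \<alpha> \<le> lagrangian f g (x + t *\<^sub>R ?d) x \<alpha>"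
          using le by blast
        then have "f x \<le> f (x + t *\<^sub>R ?d) + t * (\<alpha> \<bullet> ?d)"
          using a by (simp add: lagrangian_def)
        then show ?thesis
          using that by (simp add: field_simps)
      qed
      then show "\<forall>\<^sub>F t in at_right 0. 0 \<le> (f (x + t *\<^sub>R ?d) - f x) / t + \<alpha> \<bullet> ?d"
        by (auto simp: eventually_at_right[of 0 1] intro!: exI[of _ 1])
    qed simp
    then have "gradient f x + \<alpha> = 0"
      by (metis inner_gt_zero_iff neg_0_le_iff_le not_le)
    then show "\<alpha> = - gradient f x"
      by (simp add: eq_neg_iff_add_eq_0 add.commute)
  next
    assume \<alpha>: "\<alpha> = - gradient f x"
    show "\<forall>x' z'. lagrangian f g x x \<alpha> \<le> lagrangian f g x' z' \<alpha>"
    proof safe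
      fix x' z'
      have "f x + gradient f x \<bullet> (x' - x) \<le> f x'"
        using strongly_convex_first_order[OF f(3,1), of x x'] f(2)
        by (smt (verit) divide_nonneg_pos mult_nonneg_nonneg zero_le_power2)
      moreover have "g x + ereal (\<alpha> \<bullet> (z' - x)) \<le> g z'"
        using global_minimizer_subgradient[OF g x f(1)] \<alpha> by simp
      ultimately show "lagrangian f g x x \<alpha> \<le> lagrangian f g x' z' \<alpha>"
        unfolding lagrangian_def a using \<alpha>
        by (cases "g z'") (auto simp: inner_diff_right)
    qed
  qed
  then show ?thesis
    using x by (simp add: optimal_pair_def)
qed

section \<open>The proximal operator and the Moreau envelope\<close>

text \<open>The inequality is an equality here, the identity for the squared norm of a convex combination.\<close>
lemma strongly_convex_quadratic:
  fixes v :: "'a::euclidean_space"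
  shows "strongly_convex (1 / \<mu>) (\<lambda>x. 1 / (2 * \<mu>) * (norm (x - v))\<^sup>2)"
  unfolding strongly_convex_def
proof (intro allI impI)
  fix x y :: 'a and a b :: real
  assume ab: "a + b = 1"
  have b: "b = 1 - a" using ab by simp
  have "a *\<^sub>R x + b *\<^sub>R y - v = a *\<^sub>R (x - v) + b *\<^sub>R (y - v)"
    unfolding b by (simp add: algebra_simps)
  moreover have "x - y = (x - v) - (y - v)"
    by simp
  moreover have "(norm (a *\<^sub>R p + b *\<^sub>R q))\<^sup>2
      = a * (norm p)\<^sup>2 + b * (norm q)\<^sup>2 - a * b * (norm (p - q))\<^sup>2" for p q :: 'a
    unfolding b power2_norm_eq_inner
    by (simp add: inner_add_left inner_add_right inner_diff_left inner_diff_right inner_commute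
        algebra_simps)
  ultimately have eq: "(norm (a *\<^sub>R x + b *\<^sub>R y - v))\<^sup>2
      = a * (norm (x - v))\<^sup>2 + b * (norm (y - v))\<^sup>2 - a * b * (norm (x - y))\<^sup>2"
    by metis
  show "1 / (2 * \<mu>) * (norm (a *\<^sub>R x + b *\<^sub>R y - v))\<^sup>2
      \<le> a * (1 / (2 * \<mu>) * (norm (x - v))\<^sup>2) + b * (1 / (2 * \<mu>) * (norm (y - v))\<^sup>2)
        - 1 / \<mu> / 2 * a * b * (norm (x - y))\<^sup>2"
    unfolding eq by (simp add: algebra_simps add_divide_distrib diff_divide_distrib)
qed

lemma gderiv_quadratic:
  fixes v x :: "'a::euclidean_space"
  shows "GDERIV (\<lambda>x. 1 / (2 * \<mu>) * (norm (x - v))\<^sup>2) x :> (1 / \<mu>) *\<^sub>R (x - v)"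
proof -
  have "((\<lambda>x. (norm (x - v))\<^sup>2) has_derivative (\<lambda>h. 2 * (h \<bullet> (x - v)))) (at x)"
    unfolding power2_norm_eq_inner
    by (auto intro!: derivative_eq_intros simp: inner_commute)
  from has_derivative_mult_right[OF this, of "1 / (2 * \<mu>)"] show ?thesis
    unfolding gderiv_def by simp
qed

locale closed_convex =
  fixes g :: "'a::euclidean_space \<Rightarrow> ereal" and \<mu> :: real
  assumes proper: "proper_fun g" and lsc: "lower_semicontinuous g" and convex: "ereal_convex g"
    and \<mu>_pos: "\<mu> > 0"
begin

definition prox :: "'a \<Rightarrow> 'a" where
  "prox v = (THE x. global_minimizer (\<lambda>x. 1 / (2 * \<mu>) * (norm (x - v))\<^sup>2) g x)"

text \<open>This is the gradient of the Moreau envelope, by \<open>gradient_moreau_env\<close> below.\<close>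
definition residual :: "'a \<Rightarrow> 'a" where
  "residual v = (1 / \<mu>) *\<^sub>R (v - prox v)"

lemma prox_minimizes: "global_minimizer (\<lambda>x. 1 / (2 * \<mu>) * (norm (x - v))\<^sup>2) g (prox v)"
  unfolding prox_def
proof (rule theI')
  have "continuous_on UNIV (\<lambda>x. 1 / (2 * \<mu>) * (norm (x - v))\<^sup>2)"
    by (intro continuous_intros)
  then show "\<exists>!x. global_minimizer (\<lambda>x. 1 / (2 * \<mu>) * (norm (x - v))\<^sup>2) g x"
    using ex1_global_minimizer[OF _ _ strongly_convex_quadratic proper lsc convex] \<mu>_pos by simp
qed

lemma prox_residual: "prox v = v - \<mu> *\<^sub>R residual v"
  using \<mu>_pos by (simp add: residual_def)

lemma g_prox_finite: "g (prox v) = ereal (real_of_ereal (g (prox v)))"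
  using global_minimizer_finite[OF proper prox_minimizes] by (metis real_of_ereal.simps(1))

lemma residual_subgradient: "g (prox v) + ereal (residual v \<bullet> (z - prox v)) \<le> g z"
proof -
  have "- ((1 / \<mu>) *\<^sub>R (prox v - v)) = residual v"
    by (simp add: residual_def flip: scaleR_minus_right)
  then show ?thesis
    using global_minimizer_subgradient[OF proper convex prox_minimizes gderiv_quadratic] by metis
qed

text \<open>The residuals at \<open>v\<close> and \<open>w\<close> are subgradients of \<open>g\<close> at the two proximal points, and subgradients
are monotone. Replacing \<open>prox v\<close> by \<open>v - \<mu> residual v\<close> turns monotonicity into cocoercivity.\<close>
lemma residual_cocoercive:
  "\<mu> * (norm (residual v - residual w))\<^sup>2 \<le> (residual v - residual w) \<bullet> (v - w)"
proof -
  have "ereal (real_of_ereal (g (prox v)) + residual v \<bullet> (prox w - prox v))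
      \<le> ereal (real_of_ereal (g (prox w)))"
    using residual_subgradient[of v "prox w"] g_prox_finite[of v] g_prox_finite[of w]
    by (metis plus_ereal.simps(1))
  moreover have "ereal (real_of_ereal (g (prox w)) + residual w \<bullet> (prox v - prox w))
      \<le> ereal (real_of_ereal (g (prox v)))"
    using residual_subgradient[of w "prox v"] g_prox_finite[of v] g_prox_finite[of w]
    by (metis plus_ereal.simps(1))
  ultimately have "0 \<le> (residual v - residual w) \<bullet> (prox v - prox w)"
    by (simp add: inner_diff_left inner_diff_right)
  also have "prox v - prox w = (v - w) - \<mu> *\<^sub>R (residual v - residual w)"
    by (simp add: prox_residual algebra_simps)
  finally show ?thesis
    by (simp only: inner_diff_right inner_scaleR_right power2_norm_eq_inner)
qed

lemma residual_lipschitz: "(1 / \<mu>)-lipschitz_on UNIV residual"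
proof (rule lipschitz_onI)
  fix v w
  let ?n = "norm (residual v - residual w)"
  have "?n * (\<mu> * ?n) \<le> ?n * norm (v - w)"
    using residual_cocoercive[of v w] norm_cauchy_schwarz[of "residual v - residual w" "v - w"]
    by (simp add: power2_eq_square algebra_simps)
  then have "\<mu> * ?n \<le> norm (v - w)"
    by (cases "?n = 0") (auto simp: mult_le_cancel_left)
  then show "dist (residual v) (residual w) \<le> 1 / \<mu> * dist v w"
    using \<mu>_pos by (simp add: dist_norm field_simps)
qed (use \<mu>_pos in simp)

lemma moreau_env_prox:
  "moreau_env \<mu> g v = real_of_ereal (g (prox v)) + 1 / (2 * \<mu>) * (norm (prox v - v))\<^sup>2"
proof -
  have "(INF x. g x + ereal (1 / (2 * \<mu>) * (norm (x - v))\<^sup>2))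
      = g (prox v) + ereal (1 / (2 * \<mu>) * (norm (prox v - v))\<^sup>2)"
    using prox_minimizes[of v]
    by (intro antisym INF_lower INF_greatest) (auto simp: global_minimizer_def add.commute)
  then show ?thesis
    unfolding moreau_env_def by (metis g_prox_finite plus_ereal.simps(1) real_of_ereal.simps(1))
qed

text \<open>The proximal point of \<open>v\<close> is a competitor in the infimum at \<open>w\<close>; expanding the square gives the
linear term exactly.\<close>
lemma moreau_env_upper:
  "moreau_env \<mu> g w
    \<le> moreau_env \<mu> g v + residual v \<bullet> (w - v) + 1 / (2 * \<mu>) * (norm (w - v))\<^sup>2"
proof -
  have "ereal (1 / (2 * \<mu>) * (norm (prox w - w))\<^sup>2) + g (prox w)
      \<le> ereal (1 / (2 * \<mu>) * (norm (prox v - w))\<^sup>2) + g (prox v)"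
    using prox_minimizes[of w] unfolding global_minimizer_def by blast
  then have "ereal (1 / (2 * \<mu>) * (norm (prox w - w))\<^sup>2 + real_of_ereal (g (prox w)))
      \<le> ereal (1 / (2 * \<mu>) * (norm (prox v - w))\<^sup>2 + real_of_ereal (g (prox v)))"
    using g_prox_finite by (metis plus_ereal.simps(1))
  then have "moreau_env \<mu> g w
      \<le> real_of_ereal (g (prox v)) + 1 / (2 * \<mu>) * (norm (prox v - w))\<^sup>2"
    by (simp add: moreau_env_prox)
  also have "prox v - w = (prox v - v) - (w - v)"
    by simp
  also have "(norm ((prox v - v) - (w - v)))\<^sup>2
      = (norm (prox v - v))\<^sup>2 - 2 * ((prox v - v) \<bullet> (w - v)) + (norm (w - v))\<^sup>2"
    unfolding power2_norm_eq_inner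
    by (simp add: inner_diff_left inner_diff_right inner_commute)
  also have "prox v - v = - (\<mu> *\<^sub>R residual v)"
    by (simp add: prox_residual)
  finally show ?thesis
    using \<mu>_pos by (simp add: moreau_env_prox prox_residual field_simps)
qed

text \<open>The upper estimate with \<open>v\<close> and \<open>w\<close> exchanged is a lower estimate with slope \<open>residual w\<close>, and
monotonicity of the residual allows this slope to be replaced by \<open>residual v\<close>. So the linearization
error is quadratic from both sides.\<close>
lemma gderiv_moreau_env: "GDERIV (moreau_env \<mu> g) v :> residual v"
  unfolding gderiv_def
proof (rule has_derivativeI_sandwich[of 1])
  show "bounded_linear (\<lambda>h. h \<bullet> residual v)"
    by (rule bounded_linear_inner_left)
  show "((\<lambda>w. 1 / (2 * \<mu>) * norm (w - v)) \<longlongrightarrow> 0) (at v)"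
    by (intro tendsto_mult_right_zero tendsto_norm_zero LIM_zero tendsto_ident_at)
  fix w assume "w \<noteq> v"
  have "0 \<le> (residual w - residual v) \<bullet> (w - v)"
    using residual_cocoercive[of w v] \<mu>_pos
    by (smt (verit) mult_nonneg_nonneg zero_le_power2)
  then have "\<bar>moreau_env \<mu> g w - moreau_env \<mu> g v - (w - v) \<bullet> residual v\<bar>
      \<le> 1 / (2 * \<mu>) * (norm (w - v))\<^sup>2"
    using moreau_env_upper[of w v] moreau_env_upper[of v w]
    by (simp add: inner_diff_left inner_diff_right inner_commute norm_minus_commute)
  then show "norm (moreau_env \<mu> g w - moreau_env \<mu> g v - (w - v) \<bullet> residual v) / norm (w - v)
      \<le> 1 / (2 * \<mu>) * norm (w - v)"
    using \<open>w \<noteq> v\<close> by (simp add: divide_le_eq power2_eq_square mult.assoc)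
qed simp

lemma gradient_moreau_env: "gradient (moreau_env \<mu> g) = residual"
  using gradient_eqI[OF gderiv_moreau_env] by (rule ext)

text \<open>Equivalently, \<open>prox (x + \<mu> \<alpha>) = x\<close>. If \<open>\<alpha>\<close> and the residual differed, they would be subgradients at
\<open>x\<close> and at the proximal point that violate monotonicity.\<close>
lemma residual_at_subgradient:
  assumes "\<And>z. g x + ereal (\<alpha> \<bullet> (z - x)) \<le> g z" and "g x = ereal a"
  shows "residual (x + \<mu> *\<^sub>R \<alpha>) = \<alpha>"
proof -
  let ?v = "x + \<mu> *\<^sub>R \<alpha>"
  obtain b where b: "g (prox ?v) = ereal b"
    using g_prox_finite by blast
  have "a + \<alpha> \<bullet> (prox ?v - x) \<le> b"
    using assms(1)[of "prox ?v"] unfolding assms(2) b by simp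
  moreover have "b + residual ?v \<bullet> (x - prox ?v) \<le> a"
    using residual_subgradient[of ?v x] unfolding assms(2) b by simp
  ultimately have "0 \<le> (\<alpha> - residual ?v) \<bullet> (x - prox ?v)"
    by (simp add: inner_diff_left inner_diff_right)
  also have "x - prox ?v = - (\<mu> *\<^sub>R (\<alpha> - residual ?v))"
    by (simp add: prox_residual algebra_simps)
  finally have "\<mu> * ((\<alpha> - residual ?v) \<bullet> (\<alpha> - residual ?v)) \<le> 0"
    by simp
  then have "(\<alpha> - residual ?v) \<bullet> (\<alpha> - residual ?v) \<le> 0"
    using \<mu>_pos by (simp add: mult_le_0_iff)
  then have "\<alpha> - residual ?v = 0"
    by (metis inner_gt_zero_iff not_le)
  then show ?thesis by simp
qed

end

section \<open>Dissipative vector fields\<close>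

text \<open>Zeros of \<open>T\<close> are the fixed points of \<open>z - h T z\<close>. The square of the Lipschitz constant of this map is
at most \<open>1 - 2 h c + h\<^sup>2 K\<^sup>2\<close>; the step \<open>h = c / (K\<^sup>2 + c\<^sup>2)\<close> bounds it by
\<open>K\<^sup>2 / (K\<^sup>2 + c\<^sup>2)\<close>, which is less than 1.\<close>
lemma ex1_zero_strongly_monotone:
  fixes T :: "'a::euclidean_space \<Rightarrow> 'a"
  assumes lip: "K-lipschitz_on UNIV T" and c: "c > 0"
    and mono: "\<And>u v. c * (norm (u - v))\<^sup>2 \<le> (T u - T v) \<bullet> (u - v)"
  shows "\<exists>!z. T z = 0"
proof -
  define h where "h = c / (K\<^sup>2 + c\<^sup>2)"
  define q where "q = K\<^sup>2 / (K\<^sup>2 + c\<^sup>2)"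
  have pos: "K\<^sup>2 + c\<^sup>2 > 0"
    using c by (simp add: add_nonneg_pos)
  have h: "h > 0"
    using c pos by (simp add: h_def)
  have q: "0 \<le> q" "q < 1"
    using c pos by (simp_all add: q_def)
  have "\<exists>!z. z - h *\<^sub>R T z = z"
  proof (rule banach_fix_type[of "sqrt q"])
    show "0 \<le> sqrt q" "sqrt q < 1"
      using q by simp_all
    show "\<forall>u v. dist (u - h *\<^sub>R T u) (v - h *\<^sub>R T v) \<le> sqrt q * dist u v"
    proof (intro allI)
      fix u v
      have "norm (T u - T v) \<le> K * norm (u - v)"
        using lipschitz_onD[OF lip, of u v] by (simp add: dist_norm)
      then have lip2: "(norm (T u - T v))\<^sup>2 \<le> K\<^sup>2 * (norm (u - v))\<^sup>2"
        by (metis norm_ge_zero power_mono power_mult_distrib)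
      have "(norm ((u - h *\<^sub>R T u) - (v - h *\<^sub>R T v)))\<^sup>2 = (norm ((u - v) - h *\<^sub>R (T u - T v)))\<^sup>2"
        by (simp add: algebra_simps)
      also have "\<dots> = (norm (u - v))\<^sup>2 - 2 * h * ((T u - T v) \<bullet> (u - v))
          + h\<^sup>2 * (norm (T u - T v))\<^sup>2"
        unfolding power2_norm_eq_inner inner_diff_left[of "u - v"] inner_diff_right[of _ "u - v"]
        by (simp add: inner_commute power2_eq_square)
      also have "\<dots> \<le> (norm (u - v))\<^sup>2 - 2 * h * (c * (norm (u - v))\<^sup>2)
          + h\<^sup>2 * (K\<^sup>2 * (norm (u - v))\<^sup>2)"
        using h by (intro add_mono diff_mono mult_left_mono mono lip2) auto
      also have "\<dots> = (1 - 2 * h * c + h\<^sup>2 * K\<^sup>2) * (norm (u - v))\<^sup>2"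
        by (simp add: algebra_simps)
      also have "\<dots> \<le> q * (norm (u - v))\<^sup>2"
      proof (rule mult_right_mono)
        have "h * c = c\<^sup>2 / (K\<^sup>2 + c\<^sup>2)"
          by (simp add: h_def power2_eq_square)
        then have "q + h * c = (K\<^sup>2 + c\<^sup>2) / (K\<^sup>2 + c\<^sup>2)"
          by (simp only: q_def add_divide_distrib)
        also have "\<dots> = 1"
          using c by (simp add: sum_power2_eq_zero_iff)
        finally have "q = 1 - h * c"
          by simp
        moreover have "h * (K\<^sup>2 + c\<^sup>2) = c"
          using pos by (simp add: h_def)
        then have "h * (h * K\<^sup>2 + h * c\<^sup>2) = h * c"
          by (simp only: distrib_left)
        then have "h\<^sup>2 * K\<^sup>2 = h * c - h\<^sup>2 * c\<^sup>2"
          by (simp add: power2_eq_square[of h] algebra_simps)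
        moreover have "0 \<le> h\<^sup>2 * c\<^sup>2"
          by simp
        ultimately show "1 - 2 * h * c + h\<^sup>2 * K\<^sup>2 \<le> q"
          by linarith
      qed simp
      finally show "dist (u - h *\<^sub>R T u) (v - h *\<^sub>R T v) \<le> sqrt q * dist u v"
        unfolding dist_norm
        by (metis norm_ge_zero real_le_rsqrt real_sqrt_mult real_sqrt_unique)
    qed
  qed
  then show ?thesis
    using h by simp
qed

text \<open>The product of the squared distance to the equilibrium and \<open>exp (r t)\<close> has a nonpositive derivative.\<close>
lemma dissipative_exponential_decay:
  fixes G :: "'a::real_inner \<Rightarrow> 'a"
  assumes diss: "\<And>u. (G u - G z) \<bullet> (u - z) \<le> - (r / 2) * (norm (u - z))\<^sup>2"
    and eq: "equilibrium G z" and sol: "solution G \<zeta>" and t: "t \<ge> 0"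
  shows "(norm (\<zeta> t - z))\<^sup>2 \<le> (norm (\<zeta> 0 - z))\<^sup>2 * exp (- r * t)"
proof -
  define V where "V = (\<lambda>t. ((\<zeta> t - z) \<bullet> (\<zeta> t - z)) * exp (r * t))"
  have V': "(V has_real_derivative
      (2 * (G (\<zeta> \<tau>) \<bullet> (\<zeta> \<tau> - z)) + r * ((\<zeta> \<tau> - z) \<bullet> (\<zeta> \<tau> - z))) * exp (r * \<tau>)) (at \<tau> within {0..})"
    if "\<tau> \<ge> 0" for \<tau>
  proof -
    have "(\<zeta> has_derivative (\<lambda>h. h *\<^sub>R G (\<zeta> \<tau>))) (at \<tau> within {0..})"
      using sol that by (auto simp: solution_def has_vector_derivative_def)
    then show ?thesis
      unfolding V_def has_field_derivative_def
      by (auto intro!: derivative_eq_intros simp: inner_commute algebra_simps)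
  qed
  have "V t \<le> V 0"
  proof (rule DERIV_nonpos_imp_decreasing_open[OF t])
    show "continuous_on {0..t} V"
      by (rule continuous_on_subset[of "{0..}"])
        (auto simp: continuous_on_eq_continuous_within intro: DERIV_continuous V')
    fix \<tau> assume \<tau>: "0 < \<tau>" "\<tau> < t"
    have "at \<tau> within {0..} = at \<tau>"
      using \<tau> by (intro at_within_interior) simp
    moreover have "2 * (G (\<zeta> \<tau>) \<bullet> (\<zeta> \<tau> - z)) + r * ((\<zeta> \<tau> - z) \<bullet> (\<zeta> \<tau> - z)) \<le> 0"
      using diss[of "\<zeta> \<tau>"] eq by (simp add: equilibrium_def power2_norm_eq_inner)
    ultimately show "\<exists>y. (V has_real_derivative y) (at \<tau>) \<and> y \<le> 0"
      using V'[of \<tau>] \<tau> by (auto simp: mult_le_0_iff)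
  qed
  then have "(norm (\<zeta> t - z))\<^sup>2 * exp (r * t) \<le> (norm (\<zeta> 0 - z))\<^sup>2"
    by (simp add: V_def power2_norm_eq_inner)
  then show ?thesis
    by (simp add: exp_minus field_simps)
qed

text \<open>Dissipativity in the inner product that weights the second component by \<open>p\<close> becomes ordinary
dissipativity after multiplying the second component by \<open>sqrt p\<close>. This rescaling \<open>S\<close> is a linear
isomorphism, so equilibria, solutions and exponential decay carry over in both directions.\<close>
lemma weighted_dissipative_equilibrium:
  fixes F :: "'a::euclidean_space \<times> 'a \<Rightarrow> 'a \<times> 'a"
  assumes lip: "K-lipschitz_on UNIV F" and p: "p > 0" and r: "r > 0"
    and diss: "\<And>u v. fst (F u - F v) \<bullet> fst (u - v) + p * (snd (F u - F v) \<bullet> snd (u - v))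
      \<le> - (r / 2) * ((norm (fst (u - v)))\<^sup>2 + p * (norm (snd (u - v)))\<^sup>2)"
  shows "\<exists>!z. equilibrium F z"
    and "equilibrium F z \<Longrightarrow> solution F \<zeta> \<Longrightarrow>
      \<exists>c>0. \<forall>t\<ge>0. (norm (\<zeta> t - z))\<^sup>2 \<le> c * exp (- r * t)"
proof -
  define S :: "real \<Rightarrow> 'a \<times> 'a \<Rightarrow> 'a \<times> 'a" where "S = (\<lambda>a z. (fst z, a *\<^sub>R snd z))"
  define s where "s = sqrt p"
  define G where "G = (\<lambda>z. S s (F (S (1 / s) z)))"
  have s: "s > 0" "p = s * s"
    using p by (simp_all add: s_def)
  have lin: "bounded_linear (S a)" for a
    unfolding S_def
    by (intro bounded_linear_Pair bounded_linear_fst bounded_linear_snd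
        bounded_linear_compose[OF bounded_linear_scaleR_right])
  have inv: "S (1 / s) (S s z) = z" "S s (S (1 / s) z) = z" for z
    using s(1) by (simp_all add: S_def)
  have G0: "G (S s z) = 0 \<longleftrightarrow> F z = 0" for z
    using s(1) by (simp add: G_def inv S_def prod_eq_iff)
  have Gdiss: "(G u - G v) \<bullet> (u - v) \<le> - (r / 2) * (norm (u - v))\<^sup>2" for u v
  proof -
    let ?w = "u - v" and ?a = "F (S (1 / s) u) - F (S (1 / s) v)"
    have "fst ?a \<bullet> fst ?w + p * (snd ?a \<bullet> ((1 / s) *\<^sub>R snd ?w))
        \<le> - (r / 2) * ((norm (fst ?w))\<^sup>2 + p * (norm ((1 / s) *\<^sub>R snd ?w))\<^sup>2)"
      using diss[of "S (1 / s) u" "S (1 / s) v"]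
      by (simp add: S_def scaleR_diff_right[symmetric] del: norm_scaleR inner_scaleR_right)
    moreover have "p * (snd ?a \<bullet> ((1 / s) *\<^sub>R snd ?w)) = (s *\<^sub>R snd ?a) \<bullet> snd ?w"
      using s by simp
    moreover have "p * (norm ((1 / s) *\<^sub>R snd ?w))\<^sup>2 = (norm (snd ?w))\<^sup>2"
      using s by (simp add: power2_eq_square)
    moreover have "G u - G v = (fst ?a, s *\<^sub>R snd ?a)"
      by (simp add: G_def S_def scaleR_diff_right)
    moreover have "(norm ?w)\<^sup>2 = (norm (fst ?w))\<^sup>2 + (norm (snd ?w))\<^sup>2"
      by (simp add: power2_norm_eq_inner inner_prod_def)
    ultimately show ?thesis
      by (simp add: inner_prod_def)
  qed
  show "\<exists>!z. equilibrium F z"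
  proof -
    obtain A B where "A-lipschitz_on UNIV (S s)" "B-lipschitz_on UNIV (S (1 / s))"
      using bounded_linear.lipschitz_boundE[OF lin] by metis
    then have "(A * (K * B))-lipschitz_on UNIV G"
      unfolding G_def using lip
      by (intro lipschitz_on_compose2[where g = "S s"] lipschitz_on_compose2[where g = F])
        (auto intro: lipschitz_on_subset)
    then have "(A * (K * B))-lipschitz_on UNIV (\<lambda>z. - G z)"
      by simp
    then have "\<exists>!z. - G z = 0"
    proof (rule ex1_zero_strongly_monotone)
      show "r / 2 * (norm (u - v))\<^sup>2 \<le> (- G u - - G v) \<bullet> (u - v)" for u v
        using Gdiss[of u v] by (simp add: inner_diff_left)
    qed (use r in simp)
    then have "\<exists>!z. G z = 0"
      by simp
    then show ?thesis
      unfolding equilibrium_def by (metis G0 inv)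
  qed
  assume z: "equilibrium F z" and \<zeta>: "solution F \<zeta>"
  show "\<exists>c>0. \<forall>t\<ge>0. (norm (\<zeta> t - z))\<^sup>2 \<le> c * exp (- r * t)"
  proof -
    have "solution G (\<lambda>t. S s (\<zeta> t))"
      using \<zeta> unfolding solution_def G_def inv
      by (blast intro: bounded_linear.has_vector_derivative[OF lin])
    moreover have "equilibrium G (S s z)"
      using z by (simp add: equilibrium_def G0)
    ultimately have decay: "(norm (S s (\<zeta> t) - S s z))\<^sup>2
        \<le> (norm (S s (\<zeta> 0) - S s z))\<^sup>2 * exp (- r * t)" if "t \<ge> 0" for t
      using dissipative_exponential_decay[OF Gdiss] that by blast
    \<comment> \<open>\<open>B\<close> converts the rescaled norm back to the Euclidean one; the summand 1 below keeps the
      constant positive when the solution starts at the equilibrium.\<close>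
    obtain B where B: "B > 0" "\<And>w. norm (S (1 / s) w) \<le> norm w * B"
      using bounded_linear.pos_bounded[OF lin] by metis
    let ?V = "(norm (S s (\<zeta> 0) - S s z))\<^sup>2"
    have "(norm (\<zeta> t - z))\<^sup>2 \<le> (B\<^sup>2 * ?V + 1) * exp (- r * t)" if t: "t \<ge> 0" for t
    proof -
      have "S (1 / s) (S s (\<zeta> t) - S s z) = \<zeta> t - z"
        by (simp add: bounded_linear.linear[OF lin] linear_diff inv)
      then have "norm (\<zeta> t - z) \<le> norm (S s (\<zeta> t) - S s z) * B"
        using B(2) by metis
      then have "(norm (\<zeta> t - z))\<^sup>2 \<le> (norm (S s (\<zeta> t) - S s z) * B)\<^sup>2"
        by (rule power_mono) simp
      also have "\<dots> = B\<^sup>2 * (norm (S s (\<zeta> t) - S s z))\<^sup>2"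
        by (simp add: power_mult_distrib mult.commute)
      also have "\<dots> \<le> B\<^sup>2 * (?V * exp (- r * t))"
        using decay[OF t] by (rule mult_left_mono) simp
      also have "\<dots> \<le> (B\<^sup>2 * ?V + 1) * exp (- r * t)"
        by (simp add: distrib_right)
      finally show ?thesis .
    qed
    moreover have "B\<^sup>2 * ?V + 1 > 0"
      by (simp add: add_nonneg_pos)
    ultimately show ?thesis
      by blast
  qed
qed

section \<open>The proximal primal-dual dynamics\<close>

text \<open>The Lyapunov estimate. The weight \<open>\<mu> / k3\<close> is the one for which the coefficient \<open>k3\<close> of \<open>e \<bullet> a\<close>
becomes \<open>\<mu>\<close>, matching the \<open>\<mu>\<close> that cocoercivity contributes when it eliminates \<open>e \<bullet> x\<close>; completing
the square in \<open>e\<close> then costs only \<open>\<mu> \<parallel>a\<parallel>\<^sup>2\<close>.\<close>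
lemma k2_crit_dissipation:
  fixes x a d e :: "'a::real_inner"
  assumes pos: "m > 0" "\<mu> > 0" "k1 > 0" "k3 > 0" and L: "L \<ge> 0"
    and mono: "m * (norm x)\<^sup>2 \<le> d \<bullet> x" and lip: "norm d \<le> L * norm x"
    and coco: "\<mu> * (norm e)\<^sup>2 \<le> e \<bullet> (x + \<mu> *\<^sub>R a)"
  shows "(- d - e) \<bullet> x + \<mu> / k3 * ((k1 *\<^sub>R d + k2 *\<^sub>R a + k3 *\<^sub>R e) \<bullet> a)
    \<le> - (rate \<mu> k1 k2 k3 m L / 2) * ((norm x)\<^sup>2 + \<mu> / k3 * (norm a)\<^sup>2)"
proof -
  define p where "p = \<mu> / k3"
  have p: "p > 0" "\<mu> = p * k3"
    using pos by (simp_all add: p_def)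
  have "0 \<le> \<mu> * (norm (e - a))\<^sup>2"
    using pos by simp
  then have e: "- (e \<bullet> x) + \<mu> * (e \<bullet> a) \<le> \<mu> * (norm a)\<^sup>2"
    using coco
    by (simp add: power2_norm_eq_inner inner_diff_left inner_diff_right inner_add_right
        inner_commute algebra_simps)
  \<comment> \<open>Young's inequality, weighted to use up exactly half of the term \<open>m \<parallel>x\<parallel>\<^sup>2\<close>.\<close>
  have d: "p * k1 * (d \<bullet> a) \<le> m / 2 * (norm x)\<^sup>2 + (p * k1 * L)\<^sup>2 / (2 * m) * (norm a)\<^sup>2"
  proof -
    have "d \<bullet> a \<le> (L * norm x) * norm a"
      using norm_cauchy_schwarz[of d a] lip by (meson mult_right_mono norm_ge_zero order_trans)
    then have "p * k1 * (d \<bullet> a) \<le> p * k1 * ((L * norm x) * norm a)"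
      using p pos by (intro mult_left_mono) auto
    also have "\<dots> = (m * norm x) * (p * k1 * L * norm a) / m"
      using pos by simp
    also have "\<dots> \<le> ((m * norm x)\<^sup>2 + (p * k1 * L * norm a)\<^sup>2) / 2 / m"
      using sum_squares_bound[of "m * norm x" "p * k1 * L * norm a"] pos
      by (intro divide_right_mono) auto
    also have "\<dots> = m / 2 * (norm x)\<^sup>2 + (p * k1 * L)\<^sup>2 / (2 * m) * (norm a)\<^sup>2"
      using pos by (simp add: field_simps power2_eq_square)
    finally show ?thesis .
  qed
  have crit: "\<mu> + p * k2 + (p * k1 * L)\<^sup>2 / (2 * m) = p * (k2 - k2_crit \<mu> k1 k3 m L)"
    using pos unfolding k2_crit_def p_def by (simp add: field_simps power2_eq_square)
  have "(- d - e) \<bullet> x + p * ((k1 *\<^sub>R d + k2 *\<^sub>R a + k3 *\<^sub>R e) \<bullet> a)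
      = - (d \<bullet> x) + (- (e \<bullet> x) + \<mu> * (e \<bullet> a)) + p * k1 * (d \<bullet> a) + p * k2 * (norm a)\<^sup>2"
    unfolding p(2) power2_norm_eq_inner
    by (simp add: inner_diff_left inner_add_left algebra_simps)
  also have "\<dots> \<le> - (m / 2) * (norm x)\<^sup>2
      + (\<mu> + p * k2 + (p * k1 * L)\<^sup>2 / (2 * m)) * (norm a)\<^sup>2"
    using mono e d by (simp add: algebra_simps)
  also have "\<dots> = - (m / 2 * (norm x)\<^sup>2 - (k2 - k2_crit \<mu> k1 k3 m L) * (p * (norm a)\<^sup>2))"
    unfolding crit by (simp add: algebra_simps)
  also have "\<dots> \<le> - (rate \<mu> k1 k2 k3 m L / 2 * (norm x)\<^sup>2
      + rate \<mu> k1 k2 k3 m L / 2 * (p * (norm a)\<^sup>2))"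
  proof -
    have "rate \<mu> k1 k2 k3 m L / 2 * (norm x)\<^sup>2 \<le> m / 2 * (norm x)\<^sup>2"
      by (intro mult_right_mono) (auto simp: rate_def)
    moreover have "rate \<mu> k1 k2 k3 m L / 2 * (p * (norm a)\<^sup>2)
        \<le> - ((k2 - k2_crit \<mu> k1 k3 m L) * (p * (norm a)\<^sup>2))"
      unfolding minus_mult_left using p by (intro mult_right_mono) (auto simp: rate_def)
    ultimately show ?thesis by linarith
  qed
  finally show ?thesis
    unfolding p_def by (simp add: algebra_simps)
qed

lemma dynamics_lipschitz:
  fixes f :: "'a::euclidean_space \<Rightarrow> real"
  assumes f: "L-lipschitz_on UNIV (gradient f)"
    and g: "M-lipschitz_on UNIV (gradient (moreau_env \<mu> g))"
  shows "\<exists>K. K-lipschitz_on UNIV (dynamics f g \<mu> k1 k2 k3)"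
proof -
  have fst: "1-lipschitz_on UNIV (fst :: 'a \<times> 'a \<Rightarrow> 'a)"
    by (rule lipschitz_onI) (auto simp: dist_fst_le)
  have snd: "1-lipschitz_on UNIV (snd :: 'a \<times> 'a \<Rightarrow> 'a)"
    by (rule lipschitz_onI) (auto simp: dist_snd_le)
  have F: "(L * 1)-lipschitz_on UNIV (\<lambda>z :: 'a \<times> 'a. gradient f (fst z))"
    by (rule lipschitz_on_compose2[OF fst lipschitz_on_subset[OF f subset_UNIV]])
  have G: "(M * (1 + \<bar>\<mu>\<bar> * 1))-lipschitz_on UNIV
      (\<lambda>z :: 'a \<times> 'a. gradient (moreau_env \<mu> g) (fst z + \<mu> *\<^sub>R snd z))"
    by (rule lipschitz_on_compose2[OF lipschitz_on_add[OF fst lipschitz_on_cmult[OF snd]]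
          lipschitz_on_subset[OF g subset_UNIV]])
  show ?thesis
    unfolding dynamics_def case_prod_unfold
    by (rule exI, rule lipschitz_on_Pair[OF lipschitz_on_diff[OF lipschitz_on_minus[OF F] G]
          lipschitz_on_add[OF lipschitz_on_add[OF lipschitz_on_cmult[OF F] lipschitz_on_cmult[OF snd]]
            lipschitz_on_cmult[OF G]]])
qed

theorem theorem2:
  fixes f :: "real ^ 'n \<Rightarrow> real" and g :: "real ^ 'n \<Rightarrow> ereal"
    and m L \<mu> k1 k2 k3 :: real
  assumes "C1 f" and "m > 0" and "strongly_convex m f"
    and "L-lipschitz_on UNIV (gradient f)"
    and "proper_fun g" and "lower_semicontinuous g" and "ereal_convex g"
    and "\<not> ereal_differentiable g"
    and "\<mu> > 0" and "k1 > 0" and "k3 > 0"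
    and "k2 < k2_crit \<mu> k1 k3 m L"
  shows "k2_crit \<mu> k1 k3 m L < 0 \<and>
    rate \<mu> k1 k2 k3 m L > 0 \<and>
    (\<exists>!x. global_minimizer f g x) \<and>
    (\<exists>!\<zeta>. optimal_pair f g \<zeta>) \<and>
    (\<exists>!\<zeta>. equilibrium (dynamics f g \<mu> k1 k2 k3) \<zeta>) \<and>
    (\<forall>\<zeta>. optimal_pair f g \<zeta> \<longrightarrow>
       (equilibrium (dynamics f g \<mu> k1 k2 k3) \<zeta> \<longleftrightarrow> gradient f (fst \<zeta>) = 0)) \<and>
    (\<forall>\<zeta>star. equilibrium (dynamics f g \<mu> k1 k2 k3) \<zeta>star \<longrightarrow>
       (\<forall>\<zeta>. solution (dynamics f g \<mu> k1 k2 k3) \<zeta> \<longrightarrow>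
          (\<exists>c>0. \<forall>t\<ge>0. (norm (\<zeta> t - \<zeta>star))\<^sup>2
                    \<le> c * exp (- (1 / 2) * rate \<mu> k1 k2 k3 m L * t))))"
proof -
  interpret closed_convex g \<mu>
    using assms by unfold_locales
  let ?F = "dynamics f g \<mu> k1 k2 k3" and ?r = "rate \<mu> k1 k2 k3 m L"
  have L: "L \<ge> 0"
    using assms(4) by (rule lipschitz_on_nonneg)
  have gderiv: "GDERIV f x :> gradient f x" for x
    using assms(1) by (intro differentiable_imp_gderiv_gradient)
      (simp add: C1_def differentiable_on_def)
  have cont: "continuous_on UNIV f"
    using assms(1) by (auto simp: C1_def intro: differentiable_imp_continuous_on)
  have "0 \<le> k1\<^sup>2 * \<mu> / (2 * k3) * (L\<^sup>2 / m)"
    using assms by simp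
  then have crit: "k2_crit \<mu> k1 k3 m L \<le> - k3"
    by (simp add: k2_crit_def)
  have r: "?r > 0"
    using assms by (simp add: rate_def)
  have minimizer: "\<exists>!x. global_minimizer f g x"
    using ex1_global_minimizer[OF cont assms(2,3,5-7)] .
  have opt: "optimal_pair f g (x, \<alpha>) \<longleftrightarrow> global_minimizer f g x \<and> \<alpha> = - gradient f x" for x \<alpha>
    using optimal_pair_iff[OF gderiv _ assms(3,5,7)] assms(2) by simp
  have ex1_opt: "\<exists>!\<zeta>. optimal_pair f g \<zeta>"
    using minimizer by (auto simp: Ex1_def opt)

  have equilibrium_opt: "equilibrium ?F \<zeta> \<longleftrightarrow> gradient f (fst \<zeta>) = 0" if "optimal_pair f g \<zeta>" for \<zeta>
  proof -
    define x where "x = fst \<zeta>"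
    have x: "global_minimizer f g x" and \<zeta>: "\<zeta> = (x, - gradient f x)"
      using that opt[of "fst \<zeta>" "snd \<zeta>"] by (simp_all add: x_def prod_eq_iff)
    obtain a where a: "g x = ereal a"
      using global_minimizer_finite[OF proper x] .
    have "residual (x + \<mu> *\<^sub>R (- gradient f x)) = - gradient f x"
      using global_minimizer_subgradient[OF proper convex x gderiv] a
      by (intro residual_at_subgradient)
    then have "?F \<zeta> = (0, (k1 - k2 - k3) *\<^sub>R gradient f x)"
      unfolding \<zeta> dynamics_def gradient_moreau_env by (simp add: algebra_simps)
    \<comment> \<open>Since \<open>k2 < - k3\<close>, the factor cannot vanish.\<close>
    moreover have "k1 - k2 - k3 > 0"
      using crit assms by linarith
    ultimately show ?thesis
      by (simp add: equilibrium_def \<zeta> prod_eq_iff)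
  qed

  have diss: "fst (?F u - ?F v) \<bullet> fst (u - v) + \<mu> / k3 * (snd (?F u - ?F v) \<bullet> snd (u - v))
      \<le> - (?r / 2) * ((norm (fst (u - v)))\<^sup>2 + \<mu> / k3 * (norm (snd (u - v)))\<^sup>2)" for u v
  proof -
    let ?x = "fst (u - v)" and ?a = "snd (u - v)"
    let ?d = "gradient f (fst u) - gradient f (fst v)"
    let ?y = "\<lambda>u. fst u + \<mu> *\<^sub>R snd u"
    let ?e = "residual (?y u) - residual (?y v)"
    have "(- ?d - ?e) \<bullet> ?x + \<mu> / k3 * ((k1 *\<^sub>R ?d + k2 *\<^sub>R ?a + k3 *\<^sub>R ?e) \<bullet> ?a)
        \<le> - (?r / 2) * ((norm ?x)\<^sup>2 + \<mu> / k3 * (norm ?a)\<^sup>2)"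
    proof (rule k2_crit_dissipation)
      show "m * (norm ?x)\<^sup>2 \<le> ?d \<bullet> ?x"
        using strongly_convex_gradient_monotone[OF assms(3) gderiv gderiv] by simp
      show "norm ?d \<le> L * norm ?x"
        using lipschitz_onD[OF assms(4), of "fst u" "fst v"] by (simp add: dist_norm)
      have "?y u - ?y v = ?x + \<mu> *\<^sub>R ?a"
        by (simp add: algebra_simps)
      then show "\<mu> * (norm ?e)\<^sup>2 \<le> ?e \<bullet> (?x + \<mu> *\<^sub>R ?a)"
        using residual_cocoercive by metis
    qed (use assms L in auto)
    moreover have "fst (?F u - ?F v) = - ?d - ?e"
      "snd (?F u - ?F v) = k1 *\<^sub>R ?d + k2 *\<^sub>R ?a + k3 *\<^sub>R ?e"
      by (simp_all add: dynamics_def case_prod_unfold gradient_moreau_env algebra_simps)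
    ultimately show ?thesis
      by simp
  qed
  obtain K where lip: "K-lipschitz_on UNIV ?F"
    using dynamics_lipschitz[OF assms(4)] residual_lipschitz gradient_moreau_env by metis
  have p: "\<mu> / k3 > 0"
    using assms by simp
  note stable = weighted_dissipative_equilibrium[OF lip p r diss]
  have "\<exists>c>0. \<forall>t\<ge>0. (norm (\<zeta> t - \<zeta>star))\<^sup>2 \<le> c * exp (- (1 / 2) * ?r * t)"
    if sol: "equilibrium ?F \<zeta>star" "solution ?F \<zeta>" for \<zeta> \<zeta>star
  proof -
    obtain c where c: "c > 0" "\<And>t. t \<ge> 0 \<Longrightarrow> (norm (\<zeta> t - \<zeta>star))\<^sup>2 \<le> c * exp (- ?r * t)"
      using stable(2)[OF sol] by blast
    have "(norm (\<zeta> t - \<zeta>star))\<^sup>2 \<le> c * exp (- (1 / 2) * ?r * t)" if t: "t \<ge> 0" for t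
    proof -
      have "c * exp (- ?r * t) \<le> c * exp (- (1 / 2) * ?r * t)"
        using c(1) r t by simp
      then show ?thesis
        using c(2)[OF t] by linarith
    qed
    then show ?thesis
      using c(1) by blast
  qed
  then show ?thesis
    using crit assms(11) r minimizer ex1_opt stable(1) equilibrium_opt by auto
qed

end
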